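(* Fix an integer $k\ge 1$. For every integer $n\ge 0$, the number of partitions of $n$ satisfying condition (P) equals the number of partitions of $n$ satisfying condition (S), where: (P) every part is either even or $\equiv 1 \pmod{2k+2}$. (S) an even part $2j$ is never adjacent to any of $2j-1,2j-3,\dots,2j-2k+1$ (the $k$ odd numbers preceding it). Moreover, the generating function of the partitions satisfying (P) is the periodic infinite product $\prod_m (1-q^m)^{-1}$ over all $m\ge1$ with $m$ even or $m\equiv 1\pmod{2k+2}$; and a partition satisfies (S) if and only if its conjugate satisfies the following condition (C): (C) if a part appears exactly $1$, $3$, $\dots$, or $2k-1$ times, then there are an even number of parts strictly greater than it.
   Context: Partitions $\lambda=(\lambda_1\ge\lambda_2\ge\dots\ge\lambda_r)$ have positive integer parts. Two parts are (immediately) adjacent if they are $\lambda_i,\lambda_{i+1}$ for some $1\le i<r$. Numbers of parts are counted with multiplicity (zero is even). The conjugate of a partition is obtained by transposing its Ferrers diagram. *)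

theory Defs
  imports
    "HOL-Analysis.Infinite_Products"
    "HOL-Computational_Algebra.Formal_Power_Series"
    "HOL-Number_Theory.Cong"
begin

definition is_partition :: "nat list \<Rightarrow> bool" where
  "is_partition xs \<longleftrightarrow> sorted_wrt (\<ge>) xs \<and> 0 \<notin> set xs"

definition partitions_of :: "nat \<Rightarrow> nat list set" where
  "partitions_of n = {xs. is_partition xs \<and> sum_list xs = n}"

definition adjacent_parts :: "nat list \<Rightarrow> nat \<Rightarrow> nat \<Rightarrow> bool" where
  "adjacent_parts xs a b \<longleftrightarrow>
     (\<exists>i. Suc i < length xs \<and>
        (a = xs ! i \<and> b = xs ! Suc i \<or> b = xs ! i \<and> a = xs ! Suc i))"

definition ferrers :: "nat list \<Rightarrow> (nat \<times> nat) set" where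
  "ferrers xs = {(i, j). i < length xs \<and> j < xs ! i}"

definition conjugate :: "nat list \<Rightarrow> nat list" where
  "conjugate xs = (THE ys. is_partition ys \<and> ferrers ys = (ferrers xs)\<inverse>)"

definition allowed_P :: "nat \<Rightarrow> nat \<Rightarrow> bool" where
  "allowed_P k m \<longleftrightarrow> even m \<or> [m = 1] (mod (2 * k + 2))"

definition cond_P :: "nat \<Rightarrow> nat list \<Rightarrow> bool" where
  "cond_P k xs \<longleftrightarrow> (\<forall>m\<in>set xs. allowed_P k m)"

(* The equation 2 * j = b + (2 * i + 1) with i < k says that b is one of
   2j - 1, 2j - 3, ..., 2j - 2k + 1, leaving out those that are negative. *)
definition cond_S :: "nat \<Rightarrow> nat list \<Rightarrow> bool" where
  "cond_S k xs \<longleftrightarrow>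
     (\<forall>j b. \<forall>i<k. 2 * j = b + (2 * i + 1) \<longrightarrow> \<not> adjacent_parts xs (2 * j) b)"

definition cond_C :: "nat \<Rightarrow> nat list \<Rightarrow> bool" where
  "cond_C k xs \<longleftrightarrow>
     (\<forall>p\<in>set xs. (\<exists>i<k. count_list xs p = 2 * i + 1) \<longrightarrow>
        even (length (filter (\<lambda>x. p < x) xs)))"

lemma finite_partitions_of: "finite (partitions_of n)"
proof (rule finite_subset)
  show "partitions_of n \<subseteq> {xs. set xs \<subseteq> {..n} \<and> length xs \<le> n}"
  proof
    fix xs assume "xs \<in> partitions_of n"
    then have z: "0 \<notin> set xs" and s: "sum_list xs = n"
      by (auto simp: partitions_of_def is_partition_def)
    have "length ys \<le> sum_list ys" if "0 \<notin> set ys" for ys :: "nat list"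
      using that by (induction ys) auto
    with z s have "length xs \<le> n" by blast
    moreover have "set xs \<subseteq> {..n}"
      using member_le_sum_list s by fastforce
    ultimately show "xs \<in> {xs. set xs \<subseteq> {..n} \<and> length xs \<le> n}" by simp
  qed
  show "finite {xs. set xs \<subseteq> {..n} \<and> length xs \<le> n}"
    by (rule finite_lists_length_le) simp
qed

lemma ferrers_inject:
  assumes "is_partition xs" "is_partition ys" "ferrers xs = ferrers ys"
  shows "xs = ys"
proof -
  have pos: "i < length zs \<longleftrightarrow> (i, 0) \<in> ferrers zs" if "is_partition zs" for zs i
    using that by (auto simp: ferrers_def is_partition_def intro!: gr0I dest: nth_mem)
  have "i < length xs \<longleftrightarrow> i < length ys" for i
    using pos assms by simp
  then have len: "length xs = length ys"
    by (meson linorder_neqE_nat less_irrefl)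
  show ?thesis
  proof (rule nth_equalityI[OF len])
    fix i assume i: "i < length xs"
    have "j < xs ! i \<longleftrightarrow> j < ys ! i" for j
    proof -
      have "(i, j) \<in> ferrers xs \<longleftrightarrow> (i, j) \<in> ferrers ys" using assms(3) by simp
      with i len show ?thesis by (simp add: ferrers_def)
    qed
    then show "xs ! i = ys ! i"
      by (meson linorder_neqE_nat less_irrefl)
  qed
qed

lemma ex_conjugate:
  assumes "is_partition xs"
  shows "\<exists>ys. is_partition ys \<and> ferrers ys = (ferrers xs)\<inverse>"
proof -
  define col where "col j = {i. i < length xs \<and> j < xs ! i}" for j
  define w where "w = (if xs = [] then 0 else hd xs)"
  define ys where "ys = map (\<lambda>j. card (col j)) [0..<w]"
  have mono: "xs ! i' \<le> xs ! i" if "i \<le> i'" "i' < length xs" for i i'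
    using assms that by (cases "i = i'")
      (auto simp: is_partition_def sorted_wrt_iff_nth_less)
  have fin: "finite (col j)" for j by (simp add: col_def)
  have down: "i \<in> col j" if "i' \<in> col j" "i \<le> i'" for i i' j
    using that mono[of i i'] by (auto simp: col_def)
  have col: "i \<in> col j \<longleftrightarrow> i < card (col j)" for i j
  proof
    assume "i \<in> col j"
    then have "{..i} \<subseteq> col j" using down by blast
    then have "card {..i} \<le> card (col j)" by (rule card_mono[OF fin])
    then show "i < card (col j)" by simp
  next
    assume lt: "i < card (col j)"
    show "i \<in> col j"
    proof (rule ccontr)
      assume "i \<notin> col j"
      then have "col j \<subseteq> {..<i}" using down by (meson lessThan_iff not_le_imp_less subsetI)
      then have "card (col j) \<le> card {..<i}" by (rule card_mono[OF finite_lessThan])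
      with lt show False by simp
    qed
  qed
  have w: "j < w" if "i \<in> col j" for i j
  proof -
    have i: "i < length xs" "j < xs ! i" using that by (auto simp: col_def)
    then have "xs \<noteq> []" by auto
    with i mono[of 0 i] show ?thesis by (simp add: w_def hd_conv_nth)
  qed
  have w0: "0 \<in> col j" if "j < w" for j
    using that by (auto simp: w_def col_def hd_conv_nth split: if_splits)
  have "is_partition ys"
    unfolding is_partition_def
  proof
    show "sorted_wrt (\<ge>) ys"
      unfolding sorted_wrt_iff_nth_less
    proof (intro allI impI)
      fix a b assume "a < b" "b < length ys"
      moreover have "card (col b) \<le> card (col a)" if "a < b"
        using that by (intro card_mono[OF fin]) (auto simp: col_def)
      ultimately show "ys ! b \<le> ys ! a" by (simp add: ys_def)
    qed
    show "0 \<notin> set ys" using w0 col by (force simp: ys_def)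
  qed
  moreover have "ferrers ys = (ferrers xs)\<inverse>"
  proof -
    have "(j, i) \<in> ferrers ys \<longleftrightarrow> (i, j) \<in> ferrers xs" for i j
    proof -
      have "(j, i) \<in> ferrers ys \<longleftrightarrow> j < w \<and> i \<in> col j"
        by (auto simp: ferrers_def ys_def col)
      also have "\<dots> \<longleftrightarrow> i \<in> col j" using w by blast
      also have "\<dots> \<longleftrightarrow> (i, j) \<in> ferrers xs" by (simp add: col_def ferrers_def)
      finally show ?thesis .
    qed
    then show ?thesis by auto
  qed
  ultimately show ?thesis by blast
qed

lemma conjugate_props:
  assumes "is_partition xs"
  shows is_partition_conjugate: "is_partition (conjugate xs)"
    and ferrers_conjugate: "ferrers (conjugate xs) = (ferrers xs)\<inverse>"
proof -
  have "\<exists>!ys. is_partition ys \<and> ferrers ys = (ferrers xs)\<inverse>"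
    using ex_conjugate[OF assms] ferrers_inject by metis
  from theI'[OF this]
  show "is_partition (conjugate xs)" "ferrers (conjugate xs) = (ferrers xs)\<inverse>"
    by (simp_all add: conjugate_def)
qed

end

theory Submission
  imports Defs
begin

text \<open>
  Reading a Ferrers diagram by columns turns (S) into (C): in the conjugate, the part \<open>q + 1\<close> occurs
  as often as the \<open>q\<close>-th row exceeds the next one (rows counted from \<open>0\<close>), and the parts above it
  are counted by that next row. An even row above an odd one at distance \<open>2 i + 1\<close> is exactly an odd
  multiplicity \<open>2 i + 1\<close> with an odd number of larger parts (\<open>cond_S_iff_cond_C_conjugate\<close>).

  Partitions with (C) are counted by building them from the largest part downwards and remembering
  only the parity \<open>b\<close> of the number of parts placed so far. For even \<open>b\<close> every multiplicity of the
  next part is admissible; for odd \<open>b\<close> an odd multiplicity has to be at least \<open>2 k + 1\<close>. Hence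
  admissible multiplicities are obtained from \<open>0\<close> or a minimal odd one (\<open>1\<close> or \<open>2 k + 1\<close>) by adding
  pairs. The pairs contribute the factor \<open>1 / (1 - q ^ (2 p))\<close> for each part size \<open>p\<close>, which accounts
  for the even parts in (P). With \<open>x = q\<close> and \<open>y = q ^ (2 k + 1)\<close> the remaining factors \<open>E\<^sub>N\<close>
  (even \<open>b\<close>, parts at most \<open>N\<close>) and \<open>O\<^sub>N\<close> (odd \<open>b\<close>) start at \<open>1\<close> and satisfy
  \<open>E\<^sub>N\<^sub>+\<^sub>1 = E\<^sub>N + x ^ (N + 1) O\<^sub>N\<close> and \<open>O\<^sub>N\<^sub>+\<^sub>1 = O\<^sub>N + y ^ (N + 1) E\<^sub>N\<close>.

  This system is solved by Rogers-Szego polynomials with base \<open>z = x y\<close>: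
  \<open>E\<^sub>N\<close> is the sum of \<open>x ^ j\<close> times the Gaussian binomial coefficient \<open>[N choose j]\<close>, and \<open>O\<^sub>N\<close> is the
  same with \<open>y\<close> for \<open>x\<close>. Indeed, the reversal \<open>j \<mapsto> N + 1 - j\<close> turns the recurrence into Pascal's rule
  (\<open>rogers_szego_Suc\<close>). As \<open>N\<close> grows, \<open>E\<^sub>N\<close> tends to the sum of \<open>x ^ j / ((1 - z) \<cdots> (1 - z ^ j))\<close>, which
  by Euler is the product of the factors \<open>1 / (1 - x z ^ a)\<close>. Since \<open>x z ^ a = q ^ (1 + (2 k + 2) a)\<close>,
  these are the parts congruent to \<open>1\<close> modulo \<open>2 k + 2\<close> in (P). The limit is taken in the quantitative
  form of a congruence modulo \<open>x ^ (N + 1)\<close> (\<open>rogers_szego_limit\<close>), which determines the coefficient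
  of \<open>q ^ N\<close>.
\<close>

section \<open>Gaussian binomial coefficients and Rogers-Szego polynomials\<close>

text \<open>This is the Gaussian binomial coefficient \<open>[j + m choose j]\<close> in base \<open>z\<close>. Indexing by \<open>j\<close> and
  \<open>m\<close> instead of \<open>j + m\<close> makes the symmetry visible and makes it the generating function of the
  multisets of size \<open>j\<close> in \<open>{0..m}\<close>; the recursion asks whether \<open>m\<close> is in the multiset.\<close>
fun gauss :: "'a::comm_ring_1 \<Rightarrow> nat \<Rightarrow> nat \<Rightarrow> 'a" where
  "gauss z 0 m = 1"
| "gauss z (Suc j) 0 = 1"
| "gauss z (Suc j) (Suc m) = gauss z (Suc j) m + z ^ Suc m * gauss z j (Suc m)"

lemma gauss_0_right [simp]: "gauss z j 0 = 1"
  by (cases j) auto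

text \<open>The other rule of Pascal: it asks whether \<open>0\<close> is in the multiset, and if not, lowers every
  element by one. Expanding both
  terms of one rule by the other gives the same three terms, which is the induction step.\<close>
lemma gauss_dual: "gauss z (Suc j) (Suc m) = z ^ Suc j * gauss z (Suc j) m + gauss z j (Suc m)"
proof (induction "j + m" arbitrary: j m rule: less_induct)
  case less
  show ?case
  proof (cases j; cases m)
    fix j' m' assume jm: "j = Suc j'" "m = Suc m'"
    have 1: "gauss z (Suc j) m = z ^ Suc j * gauss z (Suc j) m' + gauss z j m"
      using less[of j m'] jm by simp
    have 2: "gauss z j (Suc m) = z ^ j * gauss z j m + gauss z j' (Suc m)"
      using less[of j' m] jm by simp
    have 3: "gauss z (Suc j) m = gauss z (Suc j) m' + z ^ m * gauss z j m"
            "gauss z j (Suc m) = gauss z j m + z ^ Suc m * gauss z j' (Suc m)"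
      using jm by simp_all
    have "gauss z (Suc j) (Suc m) = gauss z (Suc j) m + z ^ Suc m * gauss z j (Suc m)"
      by simp
    also have "\<dots> = z ^ Suc j * gauss z (Suc j) m' + gauss z j m
        + z ^ Suc m * (z ^ j * gauss z j m + gauss z j' (Suc m))"
      by (simp only: 1 2)
    also have "\<dots> = z ^ Suc j * (gauss z (Suc j) m' + z ^ m * gauss z j m)
        + (gauss z j m + z ^ Suc m * gauss z j' (Suc m))"
      by (simp add: algebra_simps)
    finally show ?thesis by (simp only: 3[symmetric])
  next
    assume "j = 0" "m = 0" then show ?thesis by simp
  next
    fix m' assume jm: "j = 0" "m = Suc m'"
    have "gauss z 1 (Suc m) = gauss z 1 m + z ^ Suc m" by simp
    also have "gauss z 1 m = z * gauss z 1 m' + 1"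
      using less[of 0 m'] jm by simp
    also have "z * gauss z 1 m' + 1 + z ^ Suc m = z * (gauss z 1 m' + z ^ m) + 1"
      by (simp add: algebra_simps)
    also have "gauss z 1 m' + z ^ m = gauss z 1 m" using jm by simp
    finally show ?thesis using jm by simp
  next
    fix j' assume jm: "j = Suc j'" "m = 0"
    show ?thesis using less[of j' 0] jm by (simp add: algebra_simps)
  qed
qed

lemma gauss_sym: "gauss z j m = gauss z m j"
proof (induction z j m rule: gauss.induct)
  case (3 z j m)
  then show ?case by (simp add: gauss_dual[of z m j] del: gauss.simps(3)) simp
qed auto

definition rogers_szego :: "'a::comm_ring_1 \<Rightarrow> 'a \<Rightarrow> nat \<Rightarrow> 'a" where
  "rogers_szego z x N = (\<Sum>j\<le>N. x ^ j * gauss z j (N - j))"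

text \<open>The term \<open>x ^ (N + 1) * y ^ i\<close> on the right equals \<open>x ^ j * z ^ i\<close> with
  \<open>z = x * y\<close> and \<open>j = N + 1 - i\<close>. Compared at \<open>x ^ j\<close>, the claim is therefore Pascal's rule
  \<open>[N + 1 choose j] = [N choose j] + z ^ (N + 1 - j) * [N choose j - 1]\<close>.\<close>
lemma rogers_szego_Suc:
  "rogers_szego (x * y) x (Suc N) = rogers_szego (x * y) x N + x ^ Suc N * rogers_szego (x * y) y N"
proof -
  let ?g = "gauss (x * y)"
  have reindex: "(\<Sum>i\<le>N. x ^ Suc N * (y ^ i * ?g i (N - i)))
     = (\<Sum>j\<le>N. x ^ Suc N * (y ^ (N - j) * ?g (N - j) j))"
    by (subst sum.nat_diff_reindex[symmetric, of _ "Suc N", unfolded lessThan_Suc_atMost])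
       (auto intro!: sum.cong)
  have "x ^ Suc j * ?g (Suc j) (N - j) = (if j < N then x ^ Suc j * ?g (Suc j) (N - Suc j) else 0) +
     x ^ Suc N * (y ^ (N - j) * ?g (N - j) j)" if "j \<le> N" for j
  proof (cases "j = N")
    case False
    with that obtain d where d: "N = Suc (j + d)" by (metis add_Suc_right le_neq_implies_less less_imp_Suc_add)
    have "?g (Suc j) (Suc d) = ?g (Suc j) d + (x*y) ^ Suc d * ?g (Suc d) j"
      by (simp add: gauss_sym[of _ "Suc d"])
    then show ?thesis
      by (simp add: d algebra_simps power_add power_mult_distrib Suc_diff_le del: gauss.simps)
  qed simp
  then have "(\<Sum>j\<le>N. x ^ Suc j * ?g (Suc j) (N - j)) =
      (\<Sum>j\<le>N. if j < N then x ^ Suc j * ?g (Suc j) (N - Suc j) else 0) +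
      (\<Sum>j\<le>N. x ^ Suc N * (y ^ (N - j) * ?g (N - j) j))"
    by (simp add: sum.distrib[symmetric])
  moreover have "(\<Sum>j\<le>N. if j < N then x ^ Suc j * ?g (Suc j) (N - Suc j) else 0)
      = (\<Sum>j<N. x ^ Suc j * ?g (Suc j) (N - Suc j))"
    by (subst lessThan_Suc_atMost[symmetric]) simp
  moreover have "rogers_szego (x * y) x N = 1 + (\<Sum>j<N. x ^ Suc j * ?g (Suc j) (N - Suc j))"
    unfolding rogers_szego_def by (subst sum.atMost_shift) simp
  moreover have "rogers_szego (x * y) x (Suc N) = 1 + (\<Sum>j\<le>N. x ^ Suc j * ?g (Suc j) (N - j))"
    unfolding rogers_szego_def by (subst sum.atMost_Suc_shift) simp
  moreover have "x ^ Suc N * rogers_szego (x * y) y N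
      = (\<Sum>j\<le>N. x ^ Suc N * (y ^ (N - j) * ?g (N - j) j))"
    unfolding rogers_szego_def sum_distrib_left by (rule reindex)
  ultimately show ?thesis by simp
qed

text \<open>Expanding the product of the geometric series \<open>1 / (1 - x * z ^ a)\<close> for \<open>a \<le> m\<close>
  gives the sum over all \<open>j\<close> of \<open>x ^ j * gauss z j m\<close>. The congruence modulo a power of \<open>x\<close> states
  this for truncated sums, so that it makes sense in every commutative ring.\<close>
lemma gauss_product:
  "x ^ Suc J dvd (\<Prod>a\<le>m. 1 - x * z ^ a) * (\<Sum>j\<le>J. x ^ j * gauss z j m) - 1"
proof (induction m)
  case 0
  have "(1 - x) * (\<Sum>j\<le>J. x ^ j) = 1 - x ^ Suc J"
    by (rule sum_gp_basic)
  then show ?case by simp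
next
  case (Suc m)
  let ?S = "\<lambda>m. \<Sum>j\<le>J. x ^ j * gauss z j m"
  have step: "(1 - x * z ^ Suc m) * ?S (Suc m) = ?S m - x ^ Suc J * (z ^ Suc m * gauss z J (Suc m))"
  proof (induction J)
    case (Suc J)
    have g: "gauss z (Suc J) m = gauss z (Suc J) (Suc m) - z ^ Suc m * gauss z J (Suc m)"
      by simp
    show ?case
      unfolding sum.atMost_Suc distrib_left Suc g by (simp add: algebra_simps del: gauss.simps)
  qed (simp add: algebra_simps)
  let ?P = "\<Prod>a\<le>m. 1 - x * z ^ a"
  have "(\<Prod>a\<le>Suc m. 1 - x * z ^ a) * ?S (Suc m) - 1 = ?P * ((1 - x * z ^ Suc m) * ?S (Suc m)) - 1"
    by (simp add: mult.assoc)
  also have "\<dots> = (?P * ?S m - 1) - x ^ Suc J * (?P * (z ^ Suc m * gauss z J (Suc m)))"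
    unfolding step by (simp add: algebra_simps)
  finally show ?case using Suc by (simp only: dvd_diff dvd_triv_left)
qed

lemma gauss_stable: "z ^ Suc m dvd gauss z j (m + d) - gauss z j m"
proof (induction d)
  case (Suc d)
  have "z ^ Suc m dvd gauss z j (Suc (m + d)) - gauss z j (m + d)"
  proof (cases j)
    case (Suc i)
    have "z ^ Suc m dvd z ^ Suc (m + d)" by (rule le_imp_power_dvd) simp
    then show ?thesis using Suc by simp
  qed simp
  from dvd_add[OF this Suc] show ?case by simp
qed simp

text \<open>Replacing \<open>gauss z j (N - j)\<close> by \<open>gauss z j N\<close> changes it by a multiple of
  \<open>z ^ (N - j + 1)\<close>. For \<open>z = x * y\<close> this is a multiple of \<open>x ^ (N - j + 1)\<close>, and together with the
  factor \<open>x ^ j\<close> the change disappears modulo \<open>x ^ (N + 1)\<close>.\<close>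
lemma rogers_szego_limit:
  "x ^ Suc N dvd (\<Prod>a\<le>N. 1 - x * (x * y) ^ a) * rogers_szego (x * y) x N - 1"
proof -
  let ?P = "\<Prod>a\<le>N. 1 - x * (x * y) ^ a" and ?S = "\<Sum>j\<le>N. x ^ j * gauss (x * y) j N"
  have "x ^ Suc N dvd x ^ j * gauss (x * y) j N - x ^ j * gauss (x * y) j (N - j)" if "j \<le> N" for j
  proof -
    have "x ^ Suc (N - j) dvd (x * y) ^ Suc (N - j)" by (simp add: power_mult_distrib del: power_Suc)
    also have "\<dots> dvd gauss (x * y) j N - gauss (x * y) j (N - j)"
      using gauss_stable[of "x * y" "N - j" j j] that by simp
    finally have "x ^ j * x ^ Suc (N - j) dvd x ^ j * (gauss (x * y) j N - gauss (x * y) j (N - j))"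
      by (rule mult_dvd_mono[OF dvd_refl])
    moreover have "x ^ j * x ^ Suc (N - j) = x ^ Suc N" using that by (simp flip: power_add power_Suc)
    ultimately show ?thesis by (simp add: algebra_simps)
  qed
  then have "x ^ Suc N dvd ?S - rogers_szego (x * y) x N"
    unfolding rogers_szego_def sum_subtractf[symmetric] by (intro dvd_sum) auto
  then have "x ^ Suc N dvd (?P * ?S - 1) - ?P * (?S - rogers_szego (x * y) x N)"
    by (rule dvd_diff[OF gauss_product dvd_mult])
  then show ?thesis by (simp add: algebra_simps)
qed

section \<open>Generating functions of sets of partitions\<close>

definition sum_gf :: "nat list set \<Rightarrow> rat fps" where
  "sum_gf L = Abs_fps (\<lambda>n. of_nat (card {xs \<in> L. sum_list xs = n}))"

abbreviation "partitions \<equiv> {xs. is_partition xs}"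

lemma sum_gf_union:
  assumes "A \<subseteq> partitions" "B \<subseteq> partitions" "A \<inter> B = {}"
  shows "sum_gf (A \<union> B) = sum_gf A + sum_gf B"
proof (rule fps_ext)
  fix n
  let ?S = "\<lambda>L :: nat list set. {xs \<in> L. sum_list xs = n}"
  have fin: "finite (?S L)" if "L \<subseteq> partitions" for L :: "nat list set"
    by (rule finite_subset[OF _ finite_partitions_of[of n]]) (use that in \<open>auto simp: partitions_of_def\<close>)
  have "?S (A \<union> B) = ?S A \<union> ?S B" by auto
  moreover have "card (?S A \<union> ?S B) = card (?S A) + card (?S B)"
    using assms fin by (intro card_Un_disjoint) auto
  ultimately show "fps_nth (sum_gf (A \<union> B)) n = fps_nth (sum_gf A + sum_gf B) n"
    by (simp add: sum_gf_def)
qed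

lemma sum_gf_append: "sum_gf ((@) ys ` L) = fps_X ^ sum_list ys * sum_gf L"
proof (rule fps_ext)
  fix n
  let ?S = "\<lambda>(L :: nat list set) n. {xs \<in> L. sum_list xs = n}"
  have "?S ((@) ys ` L) n = (if n < sum_list ys then {} else (@) ys ` ?S L (n - sum_list ys))"
    by auto
  moreover have "card ((@) ys ` ?S L m) = card (?S L m)" for m
    by (rule card_image) (auto intro: inj_onI)
  ultimately show "fps_nth (sum_gf ((@) ys ` L)) n = fps_nth (fps_X ^ sum_list ys * sum_gf L) n"
    by (simp add: sum_gf_def fps_X_power_mult_nth)
qed

lemma sum_gf_Nil: "sum_gf {[]} = 1"
proof (rule fps_ext)
  fix n :: nat
  have "{xs \<in> {[]}. sum_list xs = n} = (if n = 0 then {[]} else {})" by auto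
  then show "fps_nth (sum_gf {[]}) n = fps_nth 1 n" by (simp add: sum_gf_def)
qed

lemma is_partition_Cons: "is_partition (M # xs) \<longleftrightarrow> 0 < M \<and> set xs \<subseteq> {..M} \<and> is_partition xs"
  by (auto simp: is_partition_def)

lemma is_partition_replicate:
  "is_partition (replicate m (Suc N) @ xs) \<longleftrightarrow> is_partition xs \<and> (m = 0 \<or> set xs \<subseteq> {..Suc N})"
  by (induction m) (auto simp: is_partition_Cons)

text \<open>Induction on the largest allowed part \<open>M\<close>: a partition either avoids \<open>M\<close> or begins with
  it, and removing that one copy again leaves a partition of the same kind. This is a linear equation
  for the generating function, so no infinite sum over multiplicities is needed.\<close>
lemma sum_gf_parts_in:
  assumes "finite A" "0 \<notin> A"
  shows "(\<Prod>m\<in>A. 1 - fps_X ^ m) * sum_gf {xs. is_partition xs \<and> set xs \<subseteq> A} = 1"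
  using assms
proof (induction A rule: finite_linorder_max_induct)
  case empty
  have "{xs. is_partition xs \<and> set xs \<subseteq> {}} = {[]}" by (auto simp: is_partition_def)
  then show ?case by (simp add: sum_gf_Nil)
next
  case (insert M A)
  let ?L = "\<lambda>A. {xs. is_partition xs \<and> set xs \<subseteq> A}"
  have "?L (insert M A) = ?L A \<union> (@) [M] ` ?L (insert M A)"
  proof (intro equalityI subsetI)
    fix xs assume xs: "xs \<in> ?L (insert M A)"
    show "xs \<in> ?L A \<union> (@) [M] ` ?L (insert M A)"
    proof (cases "M \<in> set xs")
      case True
      then obtain x ys where x: "xs = x # ys" by (cases xs) auto
      have "M \<le> x" using x True xs by (auto simp: is_partition_def)
      then have "x = M" using x xs insert.hyps by (auto simp: not_le[symmetric])
      then have "xs = [M] @ ys" "ys \<in> ?L (insert M A)" using x xs by (auto simp: is_partition_Cons)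
      then show ?thesis by blast
    qed (use xs in auto)
  next
    fix xs assume "xs \<in> ?L A \<union> (@) [M] ` ?L (insert M A)"
    then show "xs \<in> ?L (insert M A)"
      using insert by (fastforce simp: is_partition_Cons)
  qed
  moreover have "sum_gf (?L A \<union> (@) [M] ` ?L (insert M A))
      = sum_gf (?L A) + sum_gf ((@) [M] ` ?L (insert M A))"
  proof (rule sum_gf_union)
    show "(@) [M] ` ?L (insert M A) \<subseteq> partitions"
      using insert by (fastforce simp: is_partition_Cons)
    show "?L A \<inter> (@) [M] ` ?L (insert M A) = {}" using insert.hyps by auto
  qed auto
  ultimately have "sum_gf (?L (insert M A)) = sum_gf (?L A) + fps_X ^ M * sum_gf (?L (insert M A))"
    using sum_gf_append[of "[M]" "?L (insert M A)"] by simp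
  then have eq: "(1 - fps_X ^ M) * sum_gf (?L (insert M A)) = sum_gf (?L A)"
    by (simp add: algebra_simps)
  have "M \<notin> A" using insert.hyps by auto
  then have "(\<Prod>m\<in>insert M A. 1 - fps_X ^ m) * sum_gf (?L (insert M A))
      = (\<Prod>m\<in>A. 1 - fps_X ^ m) * ((1 - fps_X ^ M) * sum_gf (?L (insert M A)))"
    using insert.hyps(1) by (simp add: mult_ac)
  then show ?case using insert by (simp add: eq)
qed

section \<open>Partitions with a parity condition on multiplicities\<close>

text \<open>Condition (C) for a partition placed below \<open>b\<close> further, larger parts. Only the parity of \<open>b\<close>
  matters, see \<open>parity_cond_cong\<close>.\<close>
definition parity_cond :: "nat \<Rightarrow> nat \<Rightarrow> nat list \<Rightarrow> bool" where
  "parity_cond k b xs \<longleftrightarrow>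
     (\<forall>p\<in>set xs. odd (count_list xs p) \<and> count_list xs p < 2 * k \<longrightarrow>
        even (b + length (filter (\<lambda>x. p < x) xs)))"

lemma cond_C_eq: "cond_C k xs \<longleftrightarrow> parity_cond k 0 xs"
proof -
  have "(\<exists>i<k. c = 2 * i + 1) \<longleftrightarrow> odd c \<and> c < 2 * k" for c
    by (auto elim!: oddE)
  then show ?thesis by (simp add: cond_C_def parity_cond_def)
qed

lemma parity_cond_replicate:
  assumes "set xs \<subseteq> {..N}"
  shows "parity_cond k b (replicate m (Suc N) @ xs) \<longleftrightarrow>
     (odd m \<and> m < 2 * k \<longrightarrow> even b) \<and> parity_cond k (b + m) xs"
proof -
  have N: "count_list xs (Suc N) = 0" "filter (\<lambda>x. Suc N < x) xs = []"
    using assms by (auto simp: count_list_0_iff filter_empty_conv)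
  have rep: "count_list (replicate m (Suc N)) p = (if p = Suc N then m else 0)" for p
    by (induction m) auto
  have p: "p \<noteq> Suc N" "p < Suc N" if "p \<in> set xs" for p using that assms by fastforce+
  show ?thesis
    unfolding parity_cond_def
    by (cases "m = 0") (auto simp: N rep p ball_Un add_ac)
qed

definition parity_partitions :: "nat \<Rightarrow> nat \<Rightarrow> nat \<Rightarrow> nat list set" where
  "parity_partitions k b N = {xs. is_partition xs \<and> set xs \<subseteq> {..N} \<and> parity_cond k b xs}"

lemma parity_partitions_0: "parity_partitions k b 0 = {[]}"
  by (auto simp: parity_partitions_def parity_cond_def is_partition_def) (metis atMost_0 ex_in_conv insert_absorb set_empty singletonD subset_singleton_iff)

lemma split_largest:
  assumes "is_partition xs" "set xs \<subseteq> {..Suc N}"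
  shows "\<exists>m ys. xs = replicate m (Suc N) @ ys \<and> is_partition ys \<and> set ys \<subseteq> {..N}"
  using assms
proof (induction xs)
  case Nil
  then show ?case by simp
next
  case (Cons x xs)
  then have xs: "is_partition xs" "set xs \<subseteq> {..x}" by (auto simp: is_partition_Cons)
  show ?case
  proof (cases "x = Suc N")
    case True
    then obtain m ys where "xs = replicate m (Suc N) @ ys" "is_partition ys" "set ys \<subseteq> {..N}"
      using Cons.IH xs by blast
    with True have "x # xs = replicate (Suc m) (Suc N) @ ys \<and> is_partition ys \<and> set ys \<subseteq> {..N}"
      by simp
    then show ?thesis by blast
  next
    case False
    then have "x \<le> N" using Cons.prems by simp
    then have "x # xs = replicate 0 (Suc N) @ (x # xs)" "set (x # xs) \<subseteq> {..N}"
      using xs by auto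
    with Cons.prems show ?thesis by blast
  qed
qed

lemma replicate_mem_parity_partitions:
  assumes "is_partition xs" "set xs \<subseteq> {..N}"
  shows "replicate m (Suc N) @ xs \<in> parity_partitions k b (Suc N) \<longleftrightarrow>
     (odd m \<and> m < 2 * k \<longrightarrow> even b) \<and> parity_cond k (b + m) xs"
  using assms parity_cond_replicate[OF assms(2), of k b m]
  by (auto simp: parity_partitions_def is_partition_replicate)

lemma parity_cond_cong: "even b \<longleftrightarrow> even b' \<Longrightarrow> parity_cond k b xs = parity_cond k b' xs"
  by (simp add: parity_cond_def)

text \<open>With \<open>c b\<close> the least odd multiplicity admissible for parity \<open>b\<close>, the admissible
  multiplicities of the largest part are \<open>0\<close>, \<open>c b\<close>, and those that are two more than an admissible
  one. Neither the pair nor its removal changes a parity below.\<close>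
lemma parity_partitions_Suc:
  assumes "k \<ge> 1"
  defines "c b \<equiv> if even b then 1 else 2 * k + 1"
  shows "parity_partitions k b (Suc N) =
     (parity_partitions k b N \<union> (@) (replicate (c b) (Suc N)) ` parity_partitions k (Suc b) N)
     \<union> (@) (replicate 2 (Suc N)) ` parity_partitions k b (Suc N)" (is "?L = ?A \<union> ?B \<union> ?C")
proof (intro equalityI subsetI)
  fix xs assume xs: "xs \<in> ?L"
  then obtain m ys where ys: "xs = replicate m (Suc N) @ ys" "is_partition ys" "set ys \<subseteq> {..N}"
    using split_largest[of xs N] unfolding parity_partitions_def by blast
  have m: "odd m \<and> m < 2 * k \<longrightarrow> even b" "parity_cond k (b + m) ys"
    using xs replicate_mem_parity_partitions[OF ys(2,3), of m k b] unfolding ys(1) by blast+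
  have "m = 0 \<or> m = c b \<or> m \<ge> 2 \<and> (odd (m - 2) \<and> m - 2 < 2 * k \<longrightarrow> even b)"
  proof (cases "m < 2")
    case True
    then have "m = 0 \<or> m = 1" by auto
    then show ?thesis using m(1) assms(1) by (auto simp: c_def)
  next
    case False
    then show ?thesis using m(1) unfolding c_def by presburger
  qed
  then consider "m = 0" | "m = c b" | "m \<ge> 2" "odd (m - 2) \<and> m - 2 < 2 * k \<longrightarrow> even b"
    by blast
  then show "xs \<in> ?A \<union> ?B \<union> ?C"
  proof cases
    case 1 with ys m have "xs \<in> ?A" by (auto simp: parity_partitions_def)
    then show ?thesis by blast
  next
    case 2
    have "parity_cond k (Suc b) ys"
      using m(2) parity_cond_cong[of "b + m" "Suc b"] 2 by (auto simp: c_def)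
    with ys 2 have "xs \<in> ?B" by (auto simp: parity_partitions_def)
    then show ?thesis by blast
  next
    case 3
    have "parity_cond k (b + (m - 2)) ys"
      using m(2) parity_cond_cong[of "b + m" "b + (m - 2)"] 3(1) by simp
    then have "replicate (m - 2) (Suc N) @ ys \<in> ?L"
      using replicate_mem_parity_partitions[OF ys(2,3), of "m - 2" k b] 3(2) by blast
    moreover have "replicate m (Suc N) = replicate 2 (Suc N) @ replicate (m - 2) (Suc N)"
      by (metis 3(1) le_add_diff_inverse replicate_add)
    then have "xs = replicate 2 (Suc N) @ (replicate (m - 2) (Suc N) @ ys)"
      by (simp only: ys(1) append_assoc)
    ultimately show ?thesis by blast
  qed
next
  fix xs assume "xs \<in> ?A \<union> ?B \<union> ?C"
  then consider "xs \<in> ?A" | "xs \<in> ?B" | "xs \<in> ?C" by blast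
  then show "xs \<in> ?L"
  proof cases
    case 1 then show ?thesis
      using replicate_mem_parity_partitions[of xs N 0 k b] by (auto simp: parity_partitions_def)
  next
    case 2
    then obtain ys where ys: "xs = replicate (c b) (Suc N) @ ys" "ys \<in> parity_partitions k (Suc b) N"
      by auto
    moreover have "parity_cond k (b + c b) ys = parity_cond k (Suc b) ys"
      by (rule parity_cond_cong) (auto simp: c_def)
    ultimately show ?thesis
      using replicate_mem_parity_partitions[of ys N "c b" k b]
      by (simp add: parity_partitions_def) (simp add: c_def)
  next
    case 3
    then obtain ys where ys: "xs = replicate 2 (Suc N) @ ys" "ys \<in> ?L" by auto
    then obtain m zs where zs: "ys = replicate m (Suc N) @ zs" "is_partition zs" "set zs \<subseteq> {..N}"
      using split_largest[of ys N] unfolding parity_partitions_def by blast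
    have m: "odd m \<and> m < 2 * k \<longrightarrow> even b" "parity_cond k (b + m) zs"
      using ys(2) replicate_mem_parity_partitions[OF zs(2,3), of m k b] unfolding zs(1) by blast+
    have "xs = replicate (2 + m) (Suc N) @ zs" using ys zs by (simp only: replicate_add append_assoc)
    moreover have "parity_cond k (b + (2 + m)) zs" using m parity_cond_cong[of "b + m" "b + (2 + m)"] by simp
    ultimately show ?thesis
      using replicate_mem_parity_partitions[OF zs(2,3), of "2 + m" k b] m by simp
  qed
qed

lemma sum_gf_parity_partitions_Suc:
  assumes "k \<ge> 1"
  shows "(1 - fps_X ^ (2 * Suc N)) * sum_gf (parity_partitions k b (Suc N)) =
     sum_gf (parity_partitions k b N)
     + (if even b then fps_X else fps_X ^ (2 * k + 1)) ^ Suc N * sum_gf (parity_partitions k (Suc b) N)"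
proof -
  define c where "c = (if even b then 1 else 2 * k + 1)"
  let ?A = "parity_partitions k b N"
  let ?B = "(@) (replicate c (Suc N)) ` parity_partitions k (Suc b) N"
  let ?C = "(@) (replicate 2 (Suc N)) ` parity_partitions k b (Suc N)"
  have c: "odd c" "c > 0" by (auto simp: c_def)
  have eq: "parity_partitions k b (Suc N) = (?A \<union> ?B) \<union> ?C"
    using parity_partitions_Suc[OF assms, of b N] by (simp add: c_def)
  have sub: "?A \<subseteq> partitions" "?B \<subseteq> partitions" "?C \<subseteq> partitions"
    using eq by (auto simp: parity_partitions_def)
  have AB: "?A \<inter> ?B = {}" "?A \<inter> ?C = {}"
    using c by (auto simp: parity_partitions_def)
  have BC: "?B \<inter> ?C = {}"
  proof (rule equals0I, elim IntE imageE)
    fix xs ys zs assume a: "xs = replicate c (Suc N) @ ys" "ys \<in> parity_partitions k (Suc b) N"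
      "xs = replicate 2 (Suc N) @ zs" "zs \<in> parity_partitions k b (Suc N)"
    \<comment> \<open>For odd \<open>b\<close>, removing a pair from \<open>2 k + 1\<close> copies leaves \<open>2 k - 1\<close>, which is inadmissible.\<close>
    show False
    proof (cases "even b")
      case True
      then have "xs = Suc N # ys" using a by (simp add: c_def)
      with a(3) have "ys = Suc N # zs" by (simp add: numeral_2_eq_2)
      with a(2) show False by (auto simp: parity_partitions_def)
    next
      case False
      then have "c = 2 + (2 * k - 1)" using assms by (simp add: c_def)
      then have "xs = replicate 2 (Suc N) @ (replicate (2 * k - 1) (Suc N) @ ys)"
        by (simp only: a(1) replicate_add append_assoc)
      with a(3) have "zs = replicate (2 * k - 1) (Suc N) @ ys" by (simp only: same_append_eq)
      moreover have "is_partition ys" "set ys \<subseteq> {..N}" using a(2) by (auto simp: parity_partitions_def)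
      ultimately show False
        using replicate_mem_parity_partitions[of ys N "2 * k - 1" k b] a(4) False assms by auto
    qed
  qed
  have "sum_gf (parity_partitions k b (Suc N)) = sum_gf ?A + sum_gf ?B + sum_gf ?C"
  proof -
    have "sum_gf ((?A \<union> ?B) \<union> ?C) = sum_gf (?A \<union> ?B) + sum_gf ?C"
      by (rule sum_gf_union) (simp_all only: Un_least sub Int_Un_distrib2 AB BC Un_empty_left)
    also have "sum_gf (?A \<union> ?B) = sum_gf ?A + sum_gf ?B"
      by (rule sum_gf_union[OF sub(1,2) AB(1)])
    finally show ?thesis by (simp only: eq[symmetric])
  qed
  also have "\<dots> = sum_gf ?A + fps_X ^ (c * Suc N) * sum_gf (parity_partitions k (Suc b) N)
      + fps_X ^ (2 * Suc N) * sum_gf (parity_partitions k b (Suc N))"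
    by (simp only: sum_gf_append sum_list_replicate of_nat_id)
  finally have eq2: "sum_gf (parity_partitions k b (Suc N)) = \<dots>" .
  have "(if even b then fps_X else fps_X ^ (2 * k + 1)) ^ Suc N = (fps_X ^ (c * Suc N) :: rat fps)"
    by (simp only: c_def power_mult if_distrib[of "\<lambda>e. fps_X ^ e"] power_one_right)
  then show ?thesis
    by (simp only: left_diff_distrib mult_1_left diff_eq_eq) (rule eq2)
qed

section \<open>Conjugation exchanges the conditions (S) and (C)\<close>

lemma conjugate_conjugate: "is_partition xs \<Longrightarrow> conjugate (conjugate xs) = xs"
  by (rule ferrers_inject) (simp_all add: is_partition_conjugate ferrers_conjugate)

lemma card_ferrers: "card (ferrers xs) = sum_list xs"
proof -
  have "ferrers xs = (SIGMA i:{..<length xs}. {..<xs ! i})"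
    by (auto simp: ferrers_def)
  then show ?thesis
    by (simp add: sum_list_sum_nth atLeast0LessThan)
qed

lemma sum_list_conjugate: "is_partition xs \<Longrightarrow> sum_list (conjugate xs) = sum_list xs"
  by (simp add: ferrers_conjugate flip: card_ferrers)

lemma parts_above_conjugate:
  assumes "is_partition xs"
  shows "length (filter (\<lambda>x. q < x) (conjugate xs)) = (if q < length xs then xs ! q else 0)"
proof -
  have "j < length (conjugate xs) \<and> q < conjugate xs ! j \<longleftrightarrow> q < length xs \<and> j < xs ! q" for j
    using ferrers_conjugate[OF assms] by (auto simp: ferrers_def)
  then have "{j. j < length (conjugate xs) \<and> q < conjugate xs ! j}
      = {..<if q < length xs then xs ! q else 0}"
    by auto
  then show ?thesis by (simp add: length_filter_conv_card)
qed

lemma parts_above_Suc: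
  "length (filter (\<lambda>x. q < x) xs) = count_list xs (Suc q) + length (filter (\<lambda>x. Suc q < x) xs)"
  by (induction xs) auto

text \<open>Both conditions become the same statement about consecutive row lengths \<open>part q\<close> and
  \<open>part (q + 1)\<close>. Rows are continued by \<open>0\<close> beyond the last one; as \<open>0\<close> is even, the last part of the
  partition gives no condition, in agreement with (S).\<close>
lemma cond_S_iff_cond_C_conjugate:
  assumes xs: "is_partition xs"
  shows "cond_S k xs \<longleftrightarrow> cond_C k (conjugate xs)"
proof -
  define part where "part q = (if q < length xs then xs ! q else 0)" for q
  let ?ys = "conjugate xs"
  have pos: "0 \<notin> set ?ys" using is_partition_conjugate[OF xs] by (simp add: is_partition_def)
  have above: "length (filter (\<lambda>x. q < x) ?ys) = part q" for q
    using parts_above_conjugate[OF xs] by (simp add: part_def)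
  have count: "part q = count_list ?ys (Suc q) + part (Suc q)" for q
    using parts_above_Suc[of q ?ys] by (simp add: above)
  have mem: "p \<in> set ?ys" if "odd (count_list ?ys p)" for p
    using that by (metis count_list_0_iff even_zero)
  have C: "cond_C k ?ys \<longleftrightarrow>
      (\<forall>q. \<forall>i<k. part q = 2 * i + 1 + part (Suc q) \<longrightarrow> even (part (Suc q)))" (is "_ \<longleftrightarrow> ?C")
  proof
    assume C: "cond_C k ?ys"
    show ?C
    proof (intro allI impI)
      fix q i assume i: "i < k" "part q = 2 * i + 1 + part (Suc q)"
      then have c: "count_list ?ys (Suc q) = 2 * i + 1" using count[of q] by simp
      then have "Suc q \<in> set ?ys" by (intro mem) simp
      with C c i(1) have "even (length (filter (\<lambda>x. Suc q < x) ?ys))"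
        unfolding cond_C_def by blast
      then show "even (part (Suc q))" by (simp add: above)
    qed
  next
    assume C: ?C
    show "cond_C k ?ys"
      unfolding cond_C_def
    proof (intro ballI impI)
      fix p assume p: "p \<in> set ?ys" "\<exists>i<k. count_list ?ys p = 2 * i + 1"
      then obtain i where i: "i < k" "count_list ?ys p = 2 * i + 1" by blast
      obtain q where q: "p = Suc q" using p(1) pos by (metis not0_implies_Suc)
      have "part q = 2 * i + 1 + part (Suc q)" using count[of q] i q by simp
      with C i have "even (part (Suc q))" by blast
      then show "even (length (filter (\<lambda>x. p < x) ?ys))" by (simp add: above q)
    qed
  qed
  have desc: "xs ! Suc q \<le> xs ! q" if "Suc q < length xs" for q
    using xs that by (simp add: is_partition_def sorted_wrt_iff_nth_less)
  have "cond_S k xs \<longleftrightarrow> ?C"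
  proof
    assume S: "cond_S k xs"
    show ?C
    proof (intro allI impI, rule ccontr)
      fix q i assume i: "i < k" "part q = 2 * i + 1 + part (Suc q)" "odd (part (Suc q))"
      then have q: "Suc q < length xs" by (cases "Suc q < length xs") (auto simp: part_def)
      have "even (part q)" using i by simp
      then obtain j where j: "part q = 2 * j" by (elim evenE)
      have "adjacent_parts xs (2 * j) (part (Suc q))"
        unfolding adjacent_parts_def using q j by (intro exI[of _ q]) (auto simp: part_def)
      moreover have "2 * j = part (Suc q) + (2 * i + 1)" using i(2) j by simp
      ultimately show False using S i(1) unfolding cond_S_def by blast
    qed
  next
    assume C: ?C
    show "cond_S k xs"
      unfolding cond_S_def
    proof (intro allI impI notI)
      fix j b i assume i: "i < k" "2 * j = b + (2 * i + 1)" "adjacent_parts xs (2 * j) b"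
      then obtain q where q: "Suc q < length xs"
        "2 * j = xs ! q \<and> b = xs ! Suc q \<or> b = xs ! q \<and> 2 * j = xs ! Suc q"
        unfolding adjacent_parts_def by blast
      with desc[of q] i(2) have "part q = 2 * j" "part (Suc q) = b" by (auto simp: part_def)
      then have "even b" using C i by auto
      with i(2) show False by presburger
    qed
  qed
  with C show ?thesis by simp
qed

lemma card_cond_S_eq_card_cond_C:
  "card {xs \<in> partitions_of n. cond_S k xs} = card {xs \<in> partitions_of n. cond_C k xs}"
proof (rule bij_betw_same_card)
  show "bij_betw conjugate {xs \<in> partitions_of n. cond_S k xs} {xs \<in> partitions_of n. cond_C k xs}"
  proof (rule bij_betw_byWitness[where f' = conjugate])
    have "cond_S k (conjugate xs)" if "is_partition xs" "cond_C k xs" for xs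
      using cond_S_iff_cond_C_conjugate[OF is_partition_conjugate[OF that(1)], of k] that
      by (simp add: conjugate_conjugate)
    then show "conjugate ` {xs \<in> partitions_of n. cond_C k xs} \<subseteq> {xs \<in> partitions_of n. cond_S k xs}"
      by (auto simp: partitions_of_def is_partition_conjugate sum_list_conjugate)
  qed (auto simp: partitions_of_def conjugate_conjugate is_partition_conjugate sum_list_conjugate
         cond_S_iff_cond_C_conjugate)
qed

section \<open>Comparison with condition (P)\<close>

lemma sum_gf_parity_partitions:
  fixes k :: nat
  assumes "k \<ge> 1"
  defines "x \<equiv> fps_X" and "y \<equiv> fps_X ^ (2 * k + 1)"
  shows "(\<Prod>p=1..N. 1 - fps_X ^ (2 * p)) * sum_gf (parity_partitions k b N)
     = rogers_szego (x * y) (if even b then x else y) N"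
proof (induction N arbitrary: b)
  case 0
  then show ?case by (simp add: parity_partitions_0 sum_gf_Nil rogers_szego_def)
next
  case (Suc N)
  let ?D = "\<Prod>p=1..N. 1 - fps_X ^ (2 * p) :: rat fps"
  let ?u = "if even b then x else y" and ?v = "if even b then y else x"
  have "(\<Prod>p=1..Suc N. 1 - fps_X ^ (2 * p)) * sum_gf (parity_partitions k b (Suc N))
      = ?D * ((1 - fps_X ^ (2 * Suc N)) * sum_gf (parity_partitions k b (Suc N)))"
    by (simp add: mult.assoc)
  also have "\<dots> = ?D * (sum_gf (parity_partitions k b N)
      + ?u ^ Suc N * sum_gf (parity_partitions k (Suc b) N))"
    unfolding sum_gf_parity_partitions_Suc[OF assms(1)] x_def y_def by simp
  also have "\<dots> = ?D * sum_gf (parity_partitions k b N)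
      + ?u ^ Suc N * (?D * sum_gf (parity_partitions k (Suc b) N))"
    by (simp only: distrib_left mult.left_commute)
  also have "\<dots> = rogers_szego (x * y) ?u N + ?u ^ Suc N * rogers_szego (x * y) ?v N"
    by (simp only: Suc even_Suc if_not_P if_P if_cancel) simp
  also have "\<dots> = rogers_szego (x * y) ?u (Suc N)"
    using rogers_szego_Suc[of ?u ?v N] by (auto simp: mult.commute)
  finally show ?case .
qed

text \<open>A finite set that agrees with the parts allowed by (P) up to \<open>N\<close>. It also contains some
  larger numbers, chosen so that its product is exactly the product of the factors in
  \<open>sum_gf_parity_partitions\<close> and \<open>rogers_szego_limit\<close>.\<close>
definition P_parts :: "nat \<Rightarrow> nat \<Rightarrow> nat set" where
  "P_parts k N = (\<lambda>p. 2 * p) ` {1..N} \<union> (\<lambda>a. 1 + (2 * k + 2) * a) ` {..N}"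

lemma mem_P_parts_iff:
  assumes "0 < m" "m \<le> N"
  shows "m \<in> P_parts k N \<longleftrightarrow> allowed_P k m"
proof
  assume "m \<in> P_parts k N"
  then consider p where "m = 2 * p" | a where "m = 1 + (2 * k + 2) * a"
    unfolding P_parts_def by blast
  then show "allowed_P k m"
  proof cases
    case 2
    then show ?thesis unfolding allowed_P_def cong_def by (simp only: mod_mult_self2) blast
  qed (simp add: allowed_P_def)
next
  assume "allowed_P k m"
  then consider "even m" | "[m = 1] (mod (2 * k + 2))" unfolding allowed_P_def by blast
  then show "m \<in> P_parts k N"
  proof cases
    case 1
    then obtain p where "m = 2 * p" by (elim evenE)
    with assms show ?thesis by (auto simp: P_parts_def)
  next
    case 2
    then obtain a where "m = a * (2 * k + 2) + 1" using cong_le_nat[of 1 m] assms(1) by auto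
    then have "m = 1 + (2 * k + 2) * a" "a \<le> N" using assms(2) by (auto simp: algebra_simps)
    then show ?thesis unfolding P_parts_def by blast
  qed
qed

lemma prod_P_parts:
  "(\<Prod>m\<in>P_parts k N. 1 - fps_X ^ m) = (\<Prod>p=1..N. 1 - fps_X ^ (2 * p)) *
     (\<Prod>a\<le>N. 1 - fps_X * (fps_X * fps_X ^ (2 * k + 1)) ^ a :: rat fps)"
proof -
  have "even m" if "m \<in> (\<lambda>p. 2 * p) ` {1..N}" for m :: nat using that by auto
  moreover have "odd m" if "m \<in> (\<lambda>a. 1 + (2 * k + 2) * a) ` {..N}" for m using that by auto
  ultimately have "(\<lambda>p. 2 * p) ` {1..N} \<inter> (\<lambda>a. 1 + (2 * k + 2) * a) ` {..N} = {}"
    by blast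
  then have "(\<Prod>m\<in>P_parts k N. 1 - fps_X ^ m :: rat fps) =
      (\<Prod>m\<in>(\<lambda>p. 2 * p) ` {1..N}. 1 - fps_X ^ m) *
      (\<Prod>m\<in>(\<lambda>a. 1 + (2 * k + 2) * a) ` {..N}. 1 - fps_X ^ m)"
    unfolding P_parts_def by (intro prod.union_disjoint) auto
  also have "(\<Prod>m\<in>(\<lambda>p. 2 * p) ` {1..N}. 1 - fps_X ^ m :: rat fps) = (\<Prod>p=1..N. 1 - fps_X ^ (2 * p))"
    by (subst prod.reindex) (auto intro!: inj_onI)
  also have "(\<Prod>m\<in>(\<lambda>a. 1 + (2 * k + 2) * a) ` {..N}. 1 - fps_X ^ m :: rat fps)
      = (\<Prod>a\<le>N. 1 - fps_X ^ (1 + (2 * k + 2) * a))"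
  proof (subst prod.reindex)
    show "inj_on (\<lambda>a. 1 + (2 * k + 2) * a) {..N}"
      by (rule inj_onI) (simp only: add_left_cancel mult_cancel1, simp)
  qed simp
  also have "\<dots> = (\<Prod>a\<le>N. 1 - fps_X * (fps_X * fps_X ^ (2 * k + 1)) ^ a)"
  proof (rule prod.cong)
    fix a
    have "fps_X * fps_X ^ (2 * k + 1) = (fps_X ^ (2 * k + 2) :: rat fps)" by simp
    then have "fps_X * (fps_X * fps_X ^ (2 * k + 1)) ^ a = (fps_X ^ (1 + (2 * k + 2) * a) :: rat fps)"
      by (simp only: power_add power_one_right power_mult)
    then show "1 - fps_X ^ (1 + (2 * k + 2) * a)
        = (1 - fps_X * (fps_X * fps_X ^ (2 * k + 1)) ^ a :: rat fps)" by (simp only:)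
  qed simp
  finally show ?thesis .
qed

lemma part_le_sum: "m \<in> set xs \<Longrightarrow> m \<le> sum_list xs" for m :: nat
  by (rule member_le_sum_list) auto

lemma sum_gf_coeff_cond_P:
  assumes "\<And>m. 0 < m \<Longrightarrow> m \<le> n \<Longrightarrow> m \<in> A \<longleftrightarrow> allowed_P k m"
  shows "fps_nth (sum_gf {xs. is_partition xs \<and> set xs \<subseteq> A}) n
    = of_nat (card {xs \<in> partitions_of n. cond_P k xs})"
proof -
  have "set xs \<subseteq> A \<longleftrightarrow> cond_P k xs" if "is_partition xs" "sum_list xs = n" for xs
  proof -
    have "0 < m \<and> m \<le> n" if "m \<in> set xs" for m
      using \<open>is_partition xs\<close> \<open>sum_list xs = n\<close> that part_le_sum[OF that]
      by (auto simp: is_partition_def intro!: gr0I)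
    then show ?thesis using assms by (auto simp: cond_P_def)
  qed
  then have "{xs \<in> {xs. is_partition xs \<and> set xs \<subseteq> A}. sum_list xs = n}
      = {xs \<in> partitions_of n. cond_P k xs}"
    by (auto simp: partitions_of_def)
  then show ?thesis by (simp add: sum_gf_def)
qed

text \<open>Let \<open>D\<close> and \<open>Q\<close> be the products over the even parts and over the odd parts. Then \<open>D * Q\<close>
  inverts the generating function \<open>P\<close> for (P) exactly, and the one for (C), \<open>C\<close>, modulo \<open>q ^ (n + 1)\<close>.\<close>
lemma card_cond_P_eq_card_cond_C:
  assumes "k \<ge> 1"
  shows "card {xs \<in> partitions_of n. cond_P k xs} = card {xs \<in> partitions_of n. cond_C k xs}"
proof -
  define x y :: "rat fps" where "x = fps_X" and "y = fps_X ^ (2 * k + 1)"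
  define D :: "rat fps" where "D = (\<Prod>p=1..n. 1 - fps_X ^ (2 * p))"
  define Q where "Q = (\<Prod>a\<le>n. 1 - x * (x * y) ^ a)"
  define P where "P = sum_gf {xs. is_partition xs \<and> set xs \<subseteq> P_parts k n}"
  define C where "C = sum_gf (parity_partitions k 0 n)"
  have "finite (P_parts k n)" "0 \<notin> P_parts k n" by (auto simp: P_parts_def)
  then have "(\<Prod>m\<in>P_parts k n. 1 - fps_X ^ m) * P = 1"
    unfolding P_def by (rule sum_gf_parts_in)
  then have P: "D * Q * P = 1"
    unfolding D_def Q_def x_def y_def prod_P_parts .
  have "D * C = rogers_szego (x * y) x n"
    using sum_gf_parity_partitions[OF assms, of n 0]
    unfolding D_def C_def x_def y_def by (simp only: even_zero if_True)
  then have "x ^ Suc n dvd Q * (D * C) - 1"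
    using rogers_szego_limit[of x n y] by (simp only: Q_def)
  then have "x ^ Suc n dvd P * (Q * (D * C) - 1)" by (rule dvd_mult)
  also have "P * (Q * (D * C) - 1) = D * Q * P * C - P" by (simp add: algebra_simps)
  also have "\<dots> = C - P" by (simp add: P)
  finally obtain r where "C - P = x ^ Suc n * r" by (elim dvdE)
  then have "fps_nth (C - P) n = 0" by (simp only: x_def fps_X_power_mult_nth) simp
  then have "fps_nth C n = fps_nth P n" by simp
  moreover have "fps_nth P n = of_nat (card {xs \<in> partitions_of n. cond_P k xs})"
    unfolding P_def by (rule sum_gf_coeff_cond_P) (rule mem_P_parts_iff)
  moreover have "fps_nth C n = of_nat (card {xs \<in> partitions_of n. cond_C k xs})"
  proof -
    have "{xs \<in> parity_partitions k 0 n. sum_list xs = n} = {xs \<in> partitions_of n. cond_C k xs}"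
      by (auto simp: parity_partitions_def partitions_of_def cond_C_eq dest: part_le_sum)
    then show ?thesis by (simp add: C_def sum_gf_def)
  qed
  ultimately show ?thesis by simp
qed

lemma cond_P_has_prod:
  "(\<lambda>m. if m \<ge> 1 \<and> allowed_P k m then inverse (1 - fps_X ^ m) else 1)
     has_prod (Abs_fps (\<lambda>n. of_nat (card {xs \<in> partitions_of n. cond_P k xs})) :: rat fps)"
  (is "?f has_prod ?G")
proof -
  define A where "A N = {m \<in> {1..N}. allowed_P k m}" for N
  have partial: "(\<Prod>i\<le>N. ?f i) = sum_gf {xs. is_partition xs \<and> set xs \<subseteq> A N}" for N
  proof -
    let ?E = "\<Prod>m\<in>A N. 1 - fps_X ^ m :: rat fps"
    have "(\<Prod>i\<le>N. ?f i) = (\<Prod>m\<in>A N. inverse (1 - fps_X ^ m))"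
      by (rule prod.mono_neutral_cong_right) (auto simp: A_def)
    moreover have "(\<Prod>m\<in>A N. inverse (1 - fps_X ^ m)) * ?E = (\<Prod>m\<in>A N. 1)"
      unfolding prod.distrib[symmetric]
      by (rule prod.cong) (auto simp: A_def intro!: inverse_mult_eq_1)
    ultimately have f: "(\<Prod>i\<le>N. ?f i) * ?E = 1" by (simp only: prod.neutral_const)
    have "?E * sum_gf {xs. is_partition xs \<and> set xs \<subseteq> A N} = 1"
      by (rule sum_gf_parts_in) (auto simp: A_def)
    then have "(\<Prod>i\<le>N. ?f i) = (\<Prod>i\<le>N. ?f i) * (?E * sum_gf {xs. is_partition xs \<and> set xs \<subseteq> A N})"
      by (simp only: mult_1_right)
    also have "\<dots> = sum_gf {xs. is_partition xs \<and> set xs \<subseteq> A N}"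
      by (simp only: mult.assoc[symmetric] f mult_1_left)
    finally show ?thesis .
  qed
  have "(\<lambda>N. \<Prod>i\<le>N. ?f i) \<longlonglongrightarrow> ?G"
  proof (rule tendsto_fpsI)
    fix n
    have "fps_nth (\<Prod>i\<le>N. ?f i) n = fps_nth ?G n" if "N \<ge> n" for N
    proof -
      have "m \<in> A N \<longleftrightarrow> allowed_P k m" if "0 < m" "m \<le> n" for m
        using that \<open>N \<ge> n\<close> by (simp add: A_def)
      then show ?thesis unfolding partial fps_nth_Abs_fps by (rule sum_gf_coeff_cond_P)
    qed
    then show "\<forall>\<^sub>F N in sequentially. fps_nth (\<Prod>i\<le>N. ?f i) n = fps_nth ?G n"
      by (intro eventually_sequentiallyI)
  qed
  moreover have "?G \<noteq> 0"
  proof -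
    have "{xs \<in> partitions_of 0. cond_P k xs} = {[]}"
      by (auto simp: partitions_of_def is_partition_def cond_P_def) (metis list.set_intros(1) neq_Nil_conv)
    then have "fps_nth ?G 0 \<noteq> 0" by simp
    then show ?thesis by force
  qed
  ultimately show ?thesis 
    unfolding has_prod_def raw_has_prod_def by (simp only: add_0_right) blast
qed

theorem mainTheorem5:
  fixes k :: nat
  assumes "k \<ge> 1"
  shows "(\<forall>n. card {xs \<in> partitions_of n. cond_P k xs} = card {xs \<in> partitions_of n. cond_S k xs})
    \<and> (\<lambda>m. if m \<ge> 1 \<and> allowed_P k m then inverse (1 - fps_X ^ m) else 1)
        has_prod (Abs_fps (\<lambda>n. of_nat (card {xs \<in> partitions_of n. cond_P k xs})) :: rat fps)
    \<and> (\<forall>m. allowed_P k (m + (2 * k + 2)) \<longleftrightarrow> allowed_P k m)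
    \<and> (\<forall>xs. is_partition xs \<longrightarrow> (cond_S k xs \<longleftrightarrow> cond_C k (conjugate xs)))"
proof (intro conjI allI impI)
  show "card {xs \<in> partitions_of n. cond_P k xs} = card {xs \<in> partitions_of n. cond_S k xs}" for n
    by (simp add: card_cond_P_eq_card_cond_C[OF assms] card_cond_S_eq_card_cond_C)
  show "allowed_P k (m + (2 * k + 2)) \<longleftrightarrow> allowed_P k m" for m
    unfolding allowed_P_def cong_def by (simp only: mod_add_self2) simp
qed (rule cond_P_has_prod, rule cond_S_iff_cond_C_conjugate)

end
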